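(* Let $d\ge 2$ and $2\le k\le r$ be integers. Then $T(d+1,r,k)\ge T(d,r,k)+k-1$, and in particular $T(d,r,k)\ge 3r-2+(k-1)(d-2)$.
   Context: For integers $d\ge1$ and $2\le k\le r$, $T(d,r,k)$ denotes the minimum number $n$ such that any $n$ points $a_1,\dots,a_n\in\mathbb{R}^d$ (not necessarily distinct) admit a partition of the index set $\{1,\dots,n\}$ into $r$ pairwise disjoint sets $I_1,\dots,I_r$ such that any $k$ of the convex hulls $\operatorname{conv}\{a_i : i\in I_1\},\dots,\operatorname{conv}\{a_i : i\in I_r\}$ have a common point. *)

theory Defs
  imports "HOL-Analysis.Analysis" "HOL-Analysis.Finite_Function_Topology"
begin

(* R^d for a dimension d :: nat that may vary inside a formula: the real vectors with coordinates
   indexed by {..<d}, realised as a linear subspace of the finitely supported functions nat => real.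
   That type is a real vector space, so the library's convex hull applies; the hull of a subset of
   Rn d stays inside Rn d and is the usual one, since it depends on the linear structure only. *)
definition Rn :: "nat \<Rightarrow> (nat \<Rightarrow>\<^sub>0 real) set" where
  "Rn d = {x. Poly_Mapping.keys x \<subseteq> {..<d}}"

(* The parts are indexed by {1..r}, and "any k of the hulls" means any k distinct indices
   (two of the hulls may coincide as sets). Parts are not required to be nonempty, but for
   1 <= k <= r an empty part has an empty hull and so violates the last condition. *)
definition relaxed_tverberg_partition ::
  "nat \<Rightarrow> (nat \<Rightarrow> 'a::real_vector) \<Rightarrow> nat \<Rightarrow> nat \<Rightarrow> (nat \<Rightarrow> nat set) \<Rightarrow> bool" where
  "relaxed_tverberg_partition n a r k I \<longleftrightarrow>
     (\<Union>j\<in>{1..r}. I j) = {1..n} \<and> disjoint_family_on I {1..r} \<and>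
     (\<forall>J. J \<subseteq> {1..r} \<and> card J = k \<longrightarrow> (\<Inter>j\<in>J. convex hull (a ` I j)) \<noteq> {})"

(* A minimum exists for d >= 1 and 2 <= k <= r, because n = (d + 1) * (r - 1) + 1 has the
   property by Tverberg's theorem. *)
definition T :: "nat \<Rightarrow> nat \<Rightarrow> nat \<Rightarrow> nat" where
  "T d r k = (LEAST n. \<forall>a. (\<forall>i\<in>{1..n}. a i \<in> Rn d) \<longrightarrow>
                         (\<exists>I. relaxed_tverberg_partition n a r k I))"

end

theory Submission
  imports Defs
begin

text \<open>
  A configuration of \<open>n\<close> points in dimension \<open>d\<close> that admits no partition, extended by \<open>k - 1\<close>
  points at height 1 in dimension \<open>d + 1\<close>, still admits none: among any \<open>k\<close> parts one avoids the
  new points, so a common point of their hulls lies at height 0 and hence in the hulls of the old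
  points alone.

  In the plane, put \<open>r - 1\<close> points on each of three rays from the origin that positively span the
  plane. If the hulls of \<open>r\<close> parts meet pairwise, let \<open>m\<^sub>i \<ge> 1\<close> be the number of parts that miss ray
  \<open>i\<close>. Counting shows that fewer than \<open>m\<^sub>i\<close> parts contain two or more points of ray \<open>i\<close>. Two parts
  that miss the other two rays respectively can meet only on ray \<open>i\<close>, so one of them contains
  two points of it. Hence \<open>m\<^sub>i\<close> exceeds \<open>m\<^sub>j\<close> for some \<open>j \<noteq> i\<close>, for each of the three \<open>i\<close>, which is absurd.

  For the minimum to be attained at all, some finite number of points must suffice; iterating
  Radon's theorem gives the crude but sufficient \<open>(d + 2) ^ m\<close> points for \<open>2 ^ m\<close> parts.
\<close>

section \<open>Coordinates in \<open>Rn d\<close> and affine dependence\<close>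

lemma lookup_scaleR: "Poly_Mapping.lookup (c *\<^sub>R x) i = c *\<^sub>R Poly_Mapping.lookup x i"
proof -
  have "finite {i. c *\<^sub>R Poly_Mapping.lookup x i \<noteq> 0}"
    by (rule finite_subset[OF _ finite_lookup[of x]]) auto
  then show ?thesis
    by (simp add: scaleR_poly_mapping_def Abs_poly_mapping_inverse)
qed

lemma linear_lookup: "linear (\<lambda>x::'a \<Rightarrow>\<^sub>0 'b::real_vector. Poly_Mapping.lookup x i)"
  by (rule linearI) (simp_all add: lookup_add lookup_scaleR)

lemma mem_Rn_iff: "x \<in> Rn d \<longleftrightarrow> (\<forall>i\<ge>d. Poly_Mapping.lookup x i = 0)"
  by (auto simp: Rn_def subset_iff in_keys_iff) (metis not_le)

lemma subspace_Rn: "subspace (Rn d)"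
  by (auto simp: subspace_def mem_Rn_iff lookup_add lookup_scaleR)

lemma Rn_subset_span: "Rn d \<subseteq> span ((\<lambda>i. Poly_Mapping.single i 1) ` {..<d})"
proof
  fix x assume x: "x \<in> Rn d"
  have "x = (\<Sum>i<d. Poly_Mapping.lookup x i *\<^sub>R Poly_Mapping.single i 1)"
  proof (rule poly_mapping_eqI)
    fix j
    show "Poly_Mapping.lookup x j =
        Poly_Mapping.lookup (\<Sum>i<d. Poly_Mapping.lookup x i *\<^sub>R Poly_Mapping.single i 1) j"
      using x by (cases "j < d")
        (simp_all add: lookup_sum lookup_scaleR lookup_single when_def mem_Rn_iff if_distrib cong: if_cong)
  qed
  also have "\<dots> \<in> span ((\<lambda>i. Poly_Mapping.single i 1) ` {..<d})"
    by (intro span_sum span_scale span_base) auto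
  finally show "x \<in> span ((\<lambda>i. Poly_Mapping.single i 1) ` {..<d})" .
qed

text \<open>Translating one point of \<open>S\<close> to the origin leaves at least
  \<open>d + 1\<close> nonzero differences, all in the span of \<open>d\<close> unit
  vectors.\<close>

lemma affine_dependent_Rn:
  assumes "S \<subseteq> Rn d" "finite S" "card S \<ge> d + 2"
  shows "affine_dependent S"
proof -
  obtain a where a: "a \<in> S" using assms by fastforce
  let ?D = "(\<lambda>x. - a + x) ` (S - {a})"
  let ?B = "(\<lambda>i. Poly_Mapping.single i 1) ` {..<d} :: (nat \<Rightarrow>\<^sub>0 real) set"
  have "card ?D = card (S - {a})"
    by (rule card_image) (auto simp: inj_on_def)
  then have "card ?D \<ge> d + 1" using assms a by simp
  moreover have "?D \<subseteq> Rn d"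
    using assms a subspace_diff[OF subspace_Rn] by fastforce
  moreover have "card ?B \<le> d"
    using card_image_le[of "{..<d}"] by fastforce
  ultimately have "dependent ?D"
    using real_vector.independent_span_bound[of ?B ?D] Rn_subset_span[of d] by fastforce
  then show ?thesis using affine_dependent_iff_dependent2[OF a] by simp
qed

section \<open>A crude Tverberg bound from iterated Radon partitions\<close>

text \<open>The index set \<open>S\<close> is arbitrary so that the property applies to each block
  of a larger family. The parts need not cover \<open>S\<close>; leftover indices are distributed
  later. Numbering from 0 suits \<open>div\<close> and \<open>mod\<close>.\<close>

definition tverberg_bound :: "'a::real_vector set \<Rightarrow> nat \<Rightarrow> nat \<Rightarrow> bool" where
  "tverberg_bound V r n \<longleftrightarrow>
     (\<forall>(a :: nat \<Rightarrow> 'a) S. finite S \<and> card S = n \<and> a ` S \<subseteq> V \<longrightarrow>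
        (\<exists>I x. (\<forall>j<r. I j \<subseteq> S) \<and> disjoint_family_on I {..<r} \<and> (\<forall>j<r. x \<in> convex hull (a ` I j))))"

lemma tverberg_boundE:
  fixes a :: "nat \<Rightarrow> 'a::real_vector"
  assumes "tverberg_bound V r n" "finite S" "card S = n" "a ` S \<subseteq> V"
  obtains I x where "\<And>j. j < r \<Longrightarrow> I j \<subseteq> S" "disjoint_family_on I {..<r}"
    "\<And>j. j < r \<Longrightarrow> x \<in> convex hull (a ` I j)"
  using assms unfolding tverberg_bound_def by metis

lemma tverberg_bound_Radon: "tverberg_bound (Rn d) 2 (d + 2)"
  unfolding tverberg_bound_def
proof (intro allI impI, elim conjE)
  fix a :: "nat \<Rightarrow> nat \<Rightarrow>\<^sub>0 real" and S
  assume S: "finite S" "card S = d + 2" "a ` S \<subseteq> Rn d"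
  have "\<exists>A B x. A \<subseteq> S \<and> B \<subseteq> S \<and> A \<inter> B = {} \<and> x \<in> convex hull (a ` A) \<and> x \<in> convex hull (a ` B)"
  proof (cases "inj_on a S")
    \<comment> \<open>Radon's theorem speaks of sets, so repeated points are treated apart: two
      equal points are already two singletons with a common hull.\<close>
    case False
    then obtain i j where "i \<in> S" "j \<in> S" "i \<noteq> j" "a i = a j" by (auto simp: inj_on_def)
    then show ?thesis
      by (intro exI[of _ "{i}"] exI[of _ "{j}"] exI[of _ "a i"]) auto
  next
    case True
    then have "affine_dependent (a ` S)"
      using S by (intro affine_dependent_Rn) (auto simp: card_image)
    then obtain M P where MP: "M \<subseteq> a ` S" "P \<subseteq> a ` S" "M \<inter> P = {}"
      "convex hull M \<inter> convex hull P \<noteq> {}"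
      by (rule Radon)
    then obtain x where x: "x \<in> convex hull M" "x \<in> convex hull P" by blast
    have "a ` (S \<inter> a -` M) = M" "a ` (S \<inter> a -` P) = P" using MP by auto
    then show ?thesis using MP x
      by (intro exI[of _ "S \<inter> a -` M"] exI[of _ "S \<inter> a -` P"] exI[of _ x]) auto
  qed
  then obtain A B x where AB: "A \<subseteq> S" "B \<subseteq> S" "A \<inter> B = {}"
    "x \<in> convex hull (a ` A)" "x \<in> convex hull (a ` B)" by blast
  show "\<exists>I x. (\<forall>j<2::nat. I j \<subseteq> S) \<and> disjoint_family_on I {..<2} \<and> (\<forall>j<2. x \<in> convex hull (a ` I j))"
    using AB by (intro exI[of _ "\<lambda>j::nat. if j = 0 then A else B"] exI[of _ x])
      (auto simp: disjoint_family_on_def)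
qed

text \<open>Tverberg-partition each of \<open>n\<close> groups of \<open>m\<close> points, then the \<open>n\<close> common points obtained.\<close>
lemma tverberg_bound_mult:
  fixes V :: "'a::real_vector set"
  assumes V: "convex V" and s: "s > 0" and out: "tverberg_bound V r n" and inn: "tverberg_bound V s m"
  shows "tverberg_bound V (r * s) (n * m)"
  unfolding tverberg_bound_def
proof (intro allI impI, elim conjE)
  fix a :: "nat \<Rightarrow> 'a" and S
  assume S: "finite S" "card S = n * m" "a ` S \<subseteq> V"
  obtain h where h: "bij_betw h {..<n * m} S"
    using S ex_bij_betw_nat_finite[of S] by (auto simp: atLeast0LessThan)
  define grp where "grp g = h ` {g * m..<Suc g * m}" for g
  have blk: "{g * m..<Suc g * m} \<subseteq> {..<n * m}" if "g < n" for g
    using mult_le_mono1[of "Suc g" n m] that by auto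
  have grpS: "grp g \<subseteq> S" if "g < n" for g
    using blk[OF that] bij_betw_imp_surj_on[OF h] unfolding grp_def by blast
  have grp_card: "card (grp g) = m" if "g < n" for g
    using inj_on_subset[OF bij_betw_imp_inj_on[OF h] blk[OF that]]
    by (simp add: grp_def card_image)
  have grp_disj: "grp g \<inter> grp g' = {}" if "g < n" "g' < n" "g \<noteq> g'" for g g'
  proof -
    have "{g * m..<Suc g * m} \<inter> {g' * m..<Suc g' * m} = {}"
      using that mult_le_mono1[of "Suc g" g' m] mult_le_mono1[of "Suc g'" g m]
      by (auto simp: neq_iff)
    moreover have "grp g \<inter> grp g' = h ` ({g * m..<Suc g * m} \<inter> {g' * m..<Suc g' * m})"
      unfolding grp_def
      using inj_on_image_Int[OF bij_betw_imp_inj_on[OF h] blk blk] that by metis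
    ultimately show ?thesis by (simp only: image_empty)
  qed
  have "\<exists>F x. (\<forall>j<s. F j \<subseteq> grp g) \<and> disjoint_family_on F {..<s} \<and> (\<forall>j<s. x \<in> convex hull (a ` F j))"
    if "g < n" for g
    using inn grp_card[OF that] grpS[OF that] S finite_subset[OF grpS[OF that]]
    unfolding tverberg_bound_def by (metis image_mono subset_trans)
  then obtain F x where
    F: "\<And>g j. g < n \<Longrightarrow> j < s \<Longrightarrow> F g j \<subseteq> grp g"
    and Fd: "\<And>g. g < n \<Longrightarrow> disjoint_family_on (F g) {..<s}"
    and x: "\<And>g j. g < n \<Longrightarrow> j < s \<Longrightarrow> x g \<in> convex hull (a ` F g j)"
    by metis
  have "x ` {..<n} \<subseteq> V"
  proof (intro image_subsetI)
    fix g assume "g \<in> {..<n}"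
    then have g: "g < n" by simp
    \<comment> \<open>Part 0 exists because \<open>s > 0\<close>; it ties \<open>x g\<close> to the
      points of its group.\<close>
    have "convex hull (a ` F g 0) \<subseteq> V"
      using F[OF g s] grpS[OF g] S(3) V by (intro hull_minimal) auto
    then show "x g \<in> V" using x[OF g s] by blast
  qed
  then obtain G y where
    G: "\<And>i. i < r \<Longrightarrow> G i \<subseteq> {..<n}" and Gd: "disjoint_family_on G {..<r}"
    and y: "\<And>i. i < r \<Longrightarrow> y \<in> convex hull (x ` G i)"
    by (rule tverberg_boundE[OF out finite_lessThan card_lessThan]) (rule that)
  \<comment> \<open>The number \<open>j\<close> encodes a pair: outer part \<open>j div s\<close> of
    the groups, and inner part \<open>j mod s\<close> taken from each of these groups.\<close>
  define I where "I j = (\<Union>g\<in>G (j div s). F g (j mod s))" for j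
  have ds: "j div s < r" "j mod s < s" if "j < r * s" for j
    using that s by (auto simp: less_mult_imp_div_less)
  have "I j \<subseteq> S" if "j < r * s" for j
    using G[OF ds(1)[OF that]] F[OF _ ds(2)[OF that]] grpS unfolding I_def by blast
  moreover have "disjoint_family_on I {..<r * s}"
    unfolding disjoint_family_on_def
  proof (intro ballI impI)
    fix i j assume ij: "i \<in> {..<r * s}" "j \<in> {..<r * s}" "i \<noteq> j"
    have "F g (i mod s) \<inter> F g' (j mod s) = {}" if g: "g \<in> G (i div s)" "g' \<in> G (j div s)" for g g'
    proof -
      have gn: "g < n" "g' < n" using G ds ij g by blast+
      show ?thesis
      proof (cases "g = g'")
        case False
        then show ?thesis using grp_disj[OF gn False] F gn ds ij by blast
      next
        case True
        \<comment> \<open>A shared group forces equal outer parts, as these are disjoint; the inner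
          parts then differ and are disjoint as well.\<close>
        have "i div s = j div s"
        proof (rule ccontr)
          assume "i div s \<noteq> j div s"
          then have "G (i div s) \<inter> G (j div s) = {}"
            using Gd ds ij by (simp add: disjoint_family_on_def)
          then show False using g True by blast
        qed
        then have "i mod s \<noteq> j mod s" using ij(3) by (metis div_mult_mod_eq)
        then show ?thesis
          using Fd[OF gn(1)] ds ij True by (simp add: disjoint_family_on_def)
      qed
    qed
    then show "I i \<inter> I j = {}" unfolding I_def by blast
  qed
  moreover have "y \<in> convex hull (a ` I j)" if "j < r * s" for j
  proof -
    have "x g \<in> convex hull (a ` I j)" if g: "g \<in> G (j div s)" for g
    proof -
      have "g < n" using G ds \<open>j < r * s\<close> g by blast
      moreover have "convex hull (a ` F g (j mod s)) \<subseteq> convex hull (a ` I j)"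
        using g by (intro hull_mono image_mono) (auto simp: I_def)
      ultimately show ?thesis using x ds \<open>j < r * s\<close> by blast
    qed
    then have "convex hull (x ` G (j div s)) \<subseteq> convex hull (a ` I j)"
      by (intro hull_minimal) auto
    then show ?thesis using y[OF ds(1)[OF that]] by blast
  qed
  ultimately show "\<exists>I x. (\<forall>j<r * s. I j \<subseteq> S) \<and> disjoint_family_on I {..<r * s} \<and>
      (\<forall>j<r * s. x \<in> convex hull (a ` I j))" by blast
qed

lemma tverberg_bound_mono:
  assumes "tverberg_bound V r n" "r' \<le> r"
  shows "tverberg_bound V r' n"
  unfolding tverberg_bound_def
proof (intro allI impI, elim conjE)
  fix a :: "nat \<Rightarrow> 'a" and S
  assume S: "finite S" "card S = n" "a ` S \<subseteq> V"
  show "\<exists>I x. (\<forall>j<r'. I j \<subseteq> S) \<and> disjoint_family_on I {..<r'} \<and> (\<forall>j<r'. x \<in> convex hull (a ` I j))"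
    using tverberg_boundE[OF assms(1) S] assms(2) disjoint_family_on_mono[of "{..<r'}" "{..<r}"]
    by (metis lessThan_subset_iff less_le_trans)
qed

lemma tverberg_bound_pow2: "tverberg_bound (Rn d) (2 ^ Suc m) ((d + 2) ^ Suc m)"
proof (induction m)
  case 0
  show ?case using tverberg_bound_Radon[of d] by simp
next
  case (Suc m)
  show ?case
    using tverberg_bound_mult[OF subspace_imp_convex[OF subspace_Rn] _ tverberg_bound_Radon Suc.IH]
    by simp
qed

section \<open>Existence and monotonicity of the minimum\<close>

lemma relaxed_tverberg_partition_extend:
  assumes "1 \<le> r" and I: "\<And>j. j \<in> {1..r} \<Longrightarrow> I j \<subseteq> {1..n}" "disjoint_family_on I {1..r}"
    and hulls: "\<And>J. J \<subseteq> {1..r} \<Longrightarrow> card J = k \<Longrightarrow> (\<Inter>j\<in>J. convex hull (a ` I j)) \<noteq> {}"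
  shows "\<exists>I'. relaxed_tverberg_partition n a r k I'"
proof -
  define R where "R = {1..n} - (\<Union>j\<in>{1..r}. I j)"
  define I' where "I' = I(1 := I 1 \<union> R)"
  have "(\<Union>j\<in>{1..r}. I' j) = {1..n}"
  proof
    show "(\<Union>j\<in>{1..r}. I' j) \<subseteq> {1..n}"
    proof (intro UN_least)
      fix j assume "j \<in> {1..r}"
      then show "I' j \<subseteq> {1..n}" using I(1)[of j] by (auto simp: I'_def R_def)
    qed
    show "{1..n} \<subseteq> (\<Union>j\<in>{1..r}. I' j)"
      using \<open>1 \<le> r\<close> by (force simp: I'_def R_def)
  qed
  moreover have "disjoint_family_on I' {1..r}"
    unfolding disjoint_family_on_def
  proof (intro ballI impI)
    fix i j assume ij: "i \<in> {1..r}" "j \<in> {1..r}" "i \<noteq> j"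
    then have "I i \<inter> I j = {}" using I(2) by (simp add: disjoint_family_on_def)
    moreover have "I i \<inter> R = {}" "I j \<inter> R = {}" using ij by (auto simp: R_def)
    ultimately show "I' i \<inter> I' j = {}" using ij by (auto simp: I'_def)
  qed
  moreover have "(\<Inter>j\<in>J. convex hull (a ` I' j)) \<noteq> {}" if "J \<subseteq> {1..r}" "card J = k" for J
  proof -
    have "convex hull (a ` I j) \<subseteq> convex hull (a ` I' j)" for j
      by (intro hull_mono image_mono) (auto simp: I'_def)
    then show ?thesis using hulls[OF that] by blast
  qed
  ultimately show ?thesis unfolding relaxed_tverberg_partition_def by blast
qed

definition forces_partition :: "nat \<Rightarrow> nat \<Rightarrow> nat \<Rightarrow> nat \<Rightarrow> bool" where
  "forces_partition d r k n \<longleftrightarrow>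
     (\<forall>a. (\<forall>i\<in>{1..n}. a i \<in> Rn d) \<longrightarrow> (\<exists>I. relaxed_tverberg_partition n a r k I))"

lemma forces_partition_exists:
  assumes "1 \<le> r"
  shows "\<exists>n. forces_partition d r k n"
proof -
  have "r < 2 ^ r" by (rule less_exp)
  then have "r \<le> 2 ^ Suc r" unfolding power_Suc by linarith
  then obtain n where n: "tverberg_bound (Rn d) r n"
    using tverberg_bound_mono[OF tverberg_bound_pow2] by blast
  have "\<exists>I. relaxed_tverberg_partition n a r k I" if a: "\<forall>i\<in>{1..n}. a i \<in> Rn d" for a
  proof -
    obtain I x where I: "\<And>j. j < r \<Longrightarrow> I j \<subseteq> {1..n}" "disjoint_family_on I {..<r}"
      and x: "\<And>j. j < r \<Longrightarrow> x \<in> convex hull (a ` I j)"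
      by (rule tverberg_boundE[OF n, of "{1..n}" a]) (use a in auto)
    show ?thesis
    \<comment> \<open>The shift \<open>j - 1\<close> passes from parts numbered by
      \<open>{..<r}\<close> to parts numbered by \<open>{1..r}\<close>. A point common to all hulls
      is common to any \<open>k\<close> of them.\<close>
    proof (rule relaxed_tverberg_partition_extend[OF assms])
      show "I (j - 1) \<subseteq> {1..n}" if "j \<in> {1..r}" for j
        using that by (intro I) auto
      show "disjoint_family_on (\<lambda>j. I (j - 1)) {1..r}"
        unfolding disjoint_family_on_def
      proof (intro ballI impI)
        fix i j assume "i \<in> {1..r}" "j \<in> {1..r}" "i \<noteq> j"
        then have "i - 1 \<in> {..<r}" "j - 1 \<in> {..<r}" "i - 1 \<noteq> j - 1" by auto
        then show "I (i - 1) \<inter> I (j - 1) = {}"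
          using I(2) unfolding disjoint_family_on_def by blast
      qed
      show "(\<Inter>j\<in>J. convex hull (a ` I (j - 1))) \<noteq> {}" if "J \<subseteq> {1..r}" for J
      proof -
        have "x \<in> convex hull (a ` I (j - 1))" if "j \<in> J" for j
        proof -
          have "j \<in> {1..r}" using \<open>J \<subseteq> {1..r}\<close> that by blast
          then show ?thesis by (intro x) auto
        qed
        then show ?thesis by blast
      qed
    qed
  qed
  then show ?thesis unfolding forces_partition_def by blast
qed

text \<open>Partition the first \<open>n\<close> points and hand the remaining indices to one
  part.\<close>

lemma forces_partition_mono:
  assumes "forces_partition d r k n" "n \<le> m" "1 \<le> r"
  shows "forces_partition d r k m"
  unfolding forces_partition_def
proof (intro allI impI)
  fix a assume "\<forall>i\<in>{1..m}. a i \<in> Rn d"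
  then obtain I where "relaxed_tverberg_partition n a r k I"
    using assms unfolding forces_partition_def by fastforce
  then have I: "(\<Union>j\<in>{1..r}. I j) = {1..n}" "disjoint_family_on I {1..r}"
    "\<And>J. J \<subseteq> {1..r} \<Longrightarrow> card J = k \<Longrightarrow> (\<Inter>j\<in>J. convex hull (a ` I j)) \<noteq> {}"
    unfolding relaxed_tverberg_partition_def by blast+
  show "\<exists>I. relaxed_tverberg_partition m a r k I"
  proof (rule relaxed_tverberg_partition_extend[OF \<open>1 \<le> r\<close> _ I(2,3)])
    show "I j \<subseteq> {1..m}" if "j \<in> {1..r}" for j
    proof -
      have "I j \<subseteq> {1..n}" using I(1) that by blast
      also have "\<dots> \<subseteq> {1..m}" using \<open>n \<le> m\<close> by simp
      finally show ?thesis .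
    qed
  qed
qed

lemma T_eq_Least: "T d r k = (LEAST n. forces_partition d r k n)"
  by (simp add: T_def forces_partition_def)

text \<open>The least value is attained, and by monotonicity every number from it on forces a
  partition; so one failure bounds \<open>T\<close> from below.\<close>

lemma less_T:
  assumes "1 \<le> r" "\<not> forces_partition d r k n"
  shows "n < T d r k"
proof -
  have "forces_partition d r k (T d r k)"
    using forces_partition_exists[OF assms(1)] unfolding T_eq_Least by (rule LeastI_ex)
  then show ?thesis using forces_partition_mono assms by (meson not_less)
qed

text \<open>This makes \<open>T d r k\<close> positive, so that \<open>T d r k - 1\<close> is a true
  predecessor. Without points every part has an empty hull.\<close>

lemma not_forces_partition_0:
  assumes "1 \<le> k" "k \<le> r"
  shows "\<not> forces_partition d r k 0"
proof
  assume "forces_partition d r k 0"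
  then obtain I where I: "relaxed_tverberg_partition 0 (\<lambda>_. 0 :: nat \<Rightarrow>\<^sub>0 real) r k I"
    unfolding forces_partition_def by auto
  then have "\<And>j. j \<in> {1..r} \<Longrightarrow> I j = {}"
    unfolding relaxed_tverberg_partition_def by auto
  then have "I j = {}" if "j \<in> {1..k}" for j using that assms by auto
  moreover have "{1..k} \<subseteq> {1..r}" "card {1..k} = k" using assms by auto
  then have "(\<Inter>j\<in>{1..k}. convex hull ((\<lambda>_. 0 :: nat \<Rightarrow>\<^sub>0 real) ` I j)) \<noteq> {}"
    using I unfolding relaxed_tverberg_partition_def by blast
  ultimately show False using assms by auto
qed

section \<open>Convex hulls and linear functionals\<close>

lemma convex_hull_linear_le:
  fixes f :: "'a::real_vector \<Rightarrow> real"
  assumes f: "linear f" and le: "\<And>s. s \<in> S \<Longrightarrow> f s \<le> c" and x: "x \<in> convex hull S"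
  shows "f x \<le> c"
proof -
  have "convex hull S \<subseteq> f -` {..c}"
    using le by (intro hull_minimal convex_linear_vimage f) auto
  then show ?thesis using x by auto
qed

text \<open>The open half-space \<open>f < 0\<close> together with the hull of the points of
  \<open>S\<close> on the hyperplane \<open>f = 0\<close> is convex and contains \<open>S\<close>,
  hence contains its hull.\<close>

lemma convex_hull_face:
  fixes f :: "'a::real_vector \<Rightarrow> real"
  assumes f: "linear f" and le: "\<And>s. s \<in> S \<Longrightarrow> f s \<le> 0" and x: "x \<in> convex hull S" "f x = 0"
  shows "x \<in> convex hull (S \<inter> {s. f s = 0})"
proof -
  let ?H = "convex hull (S \<inter> {s. f s = 0})"
  let ?C = "{y. f y < 0} \<union> ?H"
  have H0: "?H \<subseteq> {s. f s = 0}"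
    by (intro hull_minimal subspace_imp_convex linear_subspace_kernel f) auto
  have "convex ?C"
  proof (rule convexI)
    fix y z and u v :: real
    assume yz: "y \<in> ?C" "z \<in> ?C" and uv: "0 \<le> u" "0 \<le> v" "u + v = 1"
    have fe: "f (u *\<^sub>R y + v *\<^sub>R z) = u * f y + v * f z"
      using f by (simp add: linear_add linear_scale)
    show "u *\<^sub>R y + v *\<^sub>R z \<in> ?C"
    \<comment> \<open>Zero weights are split off because a point with \<open>f < 0\<close> keeps the
      combination strictly negative only if its weight is positive.\<close>
    proof (cases "u = 0 \<or> v = 0")
      case True
      then show ?thesis using yz uv by auto
    next
      case False
      then have uv': "u > 0" "v > 0" using uv by auto
      have le0: "f y \<le> 0" "f z \<le> 0" using yz H0 by fastforce+
      show ?thesis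
      proof (cases "f y < 0 \<or> f z < 0")
        case True
        then have "u * f y + v * f z < 0"
          using uv' le0 by (meson add_neg_nonpos add_nonpos_neg mult_pos_neg mult_nonneg_nonpos less_imp_le)
        then show ?thesis using fe by simp
      next
        case False
        then have "y \<in> ?H" "z \<in> ?H" using yz by auto
        then show ?thesis using uv convexD[OF convex_convex_hull] by blast
      qed
    qed
  qed
  moreover have "S \<subseteq> ?C"
  proof
    fix s assume s: "s \<in> S"
    then show "s \<in> ?C"
      using le[OF s] hull_inc[of s "S \<inter> {s. f s = 0}"] by (cases "f s = 0") auto
  qed
  ultimately have "convex hull S \<subseteq> ?C" by (intro hull_minimal)
  then show ?thesis using x by auto
qed

section \<open>Raising the dimension\<close>

lemma forces_partition_lift:
  assumes F: "forces_partition (d + 1) r k (n + (k - 1))" and k: "1 \<le> k"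
  shows "forces_partition d r k n"
  unfolding forces_partition_def
proof (intro allI impI)
  fix a :: "nat \<Rightarrow> nat \<Rightarrow>\<^sub>0 real" assume a: "\<forall>i\<in>{1..n}. a i \<in> Rn d"
  \<comment> \<open>All \<open>k - 1\<close> new points coincide with the unit vector of the new
    coordinate \<open>d\<close>, and \<open>f\<close> reads off the height.\<close>
  define b where "b i = (if i \<le> n then a i else Poly_Mapping.single d 1)" for i
  define f where "f = (\<lambda>x :: nat \<Rightarrow>\<^sub>0 real. Poly_Mapping.lookup x d)"
  have f: "linear f" unfolding f_def by (rule linear_lookup)
  have fb: "f (b i) = (if i \<le> n then 0 else 1)" if "i \<ge> 1" for i
    using a that by (auto simp: f_def b_def mem_Rn_iff)
  have "b i \<in> Rn (d + 1)" if "i \<in> {1..n + (k - 1)}" for i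
    using a that by (auto simp: b_def mem_Rn_iff lookup_single when_def)
  then obtain I where "relaxed_tverberg_partition (n + (k - 1)) b r k I"
    using F unfolding forces_partition_def by blast
  then have I: "(\<Union>j\<in>{1..r}. I j) = {1..n + (k - 1)}" "disjoint_family_on I {1..r}"
    and hulls: "\<And>J. J \<subseteq> {1..r} \<Longrightarrow> card J = k \<Longrightarrow> (\<Inter>j\<in>J. convex hull (b ` I j)) \<noteq> {}"
    unfolding relaxed_tverberg_partition_def by blast+
  \<comment> \<open>Index 0 must be excluded: \<open>b 0 = a 0\<close> is unconstrained and may have
    nonzero height.\<close>
  have I1: "i \<ge> 1" if "i \<in> I j" "j \<in> {1..r}" for i j
  proof -
    have "i \<in> {1..n + (k - 1)}" using I(1) that by blast
    then show ?thesis by simp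
  qed
  have "(\<Inter>j\<in>J. convex hull (a ` (I j \<inter> {1..n}))) \<noteq> {}" if J: "J \<subseteq> {1..r}" "card J = k" for J
  proof -
    obtain x where x: "\<And>j. j \<in> J \<Longrightarrow> x \<in> convex hull (b ` I j)" using hulls[OF J] by blast
    \<comment> \<open>Otherwise choosing a new index in each of the \<open>k\<close> disjoint parts
      injects \<open>J\<close> into \<open>k - 1\<close> indices.\<close>
    have "\<exists>j\<in>J. I j \<subseteq> {1..n}"
    proof (rule ccontr)
      assume "\<not> (\<exists>j\<in>J. I j \<subseteq> {1..n})"
      then have "\<forall>j\<in>J. \<exists>i. i \<in> I j \<and> i \<notin> {1..n}" by blast
      then obtain g where g: "\<And>j. j \<in> J \<Longrightarrow> g j \<in> I j \<and> g j \<notin> {1..n}" by metis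
      have "inj_on g J"
      proof (rule inj_onI)
        fix i j assume ij: "i \<in> J" "j \<in> J" "g i = g j"
        then have "I i \<inter> I j \<noteq> {}" using g by (metis IntI empty_iff)
        then show "i = j" using I(2) ij J(1) unfolding disjoint_family_on_def by blast
      qed
      moreover have "g ` J \<subseteq> {n + 1..n + (k - 1)}"
      proof
        fix y assume "y \<in> g ` J"
        then obtain j where j: "j \<in> J" "y = g j" by blast
        then have "y \<in> {1..n + (k - 1)}" using g I(1) J(1) by blast
        then show "y \<in> {n + 1..n + (k - 1)}" using g[OF j(1)] j(2) by auto
      qed
      ultimately have "card J \<le> card {n + 1..n + (k - 1)}"
        by (intro card_inj_on_le) auto
      then show False using J(2) k by simp
    qed
    then obtain j0 where j0: "j0 \<in> J" "I j0 \<subseteq> {1..n}" by blast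
    have "convex hull (b ` I j0) \<subseteq> {s. f s = 0}"
      using j0(2) fb by (intro hull_minimal subspace_imp_convex linear_subspace_kernel f) auto
    then have fx: "f x = 0" using x[OF j0(1)] by blast
    have "x \<in> convex hull (a ` (I j \<inter> {1..n}))" if j: "j \<in> J" for j
    proof -
      have jr: "j \<in> {1..r}" using j J by blast
      \<comment> \<open>Heights are nonnegative, so the face lemma is applied to
        \<open>- f\<close>.\<close>
      have "x \<in> convex hull (b ` I j \<inter> {s. - f s = 0})"
      proof (rule convex_hull_face)
        show "linear (\<lambda>s. - f s)" using f by (rule linear_compose_neg)
        show "- f s \<le> 0" if "s \<in> b ` I j" for s
          using that fb I1[OF _ jr] by auto
      qed (use x j fx in auto)
      moreover have "b ` I j \<inter> {s. - f s = 0} \<subseteq> a ` (I j \<inter> {1..n})"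
      proof
        fix s assume "s \<in> b ` I j \<inter> {s. - f s = 0}"
        then obtain i where i: "i \<in> I j" "s = b i" "f (b i) = 0" by auto
        then have "i \<ge> 1" "i \<le> n" using fb I1[OF _ jr] by (auto split: if_splits)
        then show "s \<in> a ` (I j \<inter> {1..n})" using i by (auto simp: b_def)
      qed
      ultimately show ?thesis using hull_mono by blast
    qed
    then show ?thesis by blast
  qed
  moreover have "(\<Union>j\<in>{1..r}. I j \<inter> {1..n}) = {1..n}"
  proof -
    have "(\<Union>j\<in>{1..r}. I j \<inter> {1..n}) = {1..n + (k - 1)} \<inter> {1..n}" unfolding I(1)[symmetric] by blast
    then show ?thesis by auto
  qed
  moreover have "disjoint_family_on (\<lambda>j. I j \<inter> {1..n}) {1..r}"
    using I(2) unfolding disjoint_family_on_def by blast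
  ultimately have "relaxed_tverberg_partition n a r k (\<lambda>j. I j \<inter> {1..n})"
    unfolding relaxed_tverberg_partition_def by blast
  then show "\<exists>I. relaxed_tverberg_partition n a r k I" by blast
qed

text \<open>By minimality \<open>T d r k - 1\<close> points fail, hence so do \<open>k - 1\<close>
  more in the next dimension; the strict inequality of \<open>less_T\<close> restores the lost
  1.\<close>

lemma T_Suc_ge:
  assumes "1 \<le> k" "k \<le> r"
  shows "T d r k + (k - 1) \<le> T (d + 1) r k"
proof -
  have r: "1 \<le> r" using assms by simp
  have pos: "0 < T d r k" using less_T[OF r not_forces_partition_0[OF assms]] .
  then have "\<not> forces_partition d r k (T d r k - 1)"
    unfolding T_eq_Least by (intro not_less_Least) simp
  then have "T d r k - 1 + (k - 1) < T (d + 1) r k"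
    using forces_partition_lift[OF _ assms(1)] less_T[OF r] by blast
  then show ?thesis using pos by linarith
qed

section \<open>The planar configuration on three rays\<close>

definition tripod_ray :: "nat \<Rightarrow> nat \<Rightarrow>\<^sub>0 real" where
  "tripod_ray i = (if i = 0 then Poly_Mapping.single 0 1
     else if i = 1 then Poly_Mapping.single 1 1
     else - Poly_Mapping.single 0 1 - Poly_Mapping.single 1 1)"

text \<open>The residue modulo 3 selects the ray, and the factor \<open>n\<close> keeps points on
  one ray distinct. Index 0 would give the origin, but indices start at 1.\<close>

definition tripod :: "nat \<Rightarrow> nat \<Rightarrow>\<^sub>0 real" where
  "tripod n = real n *\<^sub>R tripod_ray (n mod 3)"

text \<open>The determinant of \<open>tripod_ray i\<close> and \<open>x\<close>.\<close>
definition tripod_side :: "nat \<Rightarrow> (nat \<Rightarrow>\<^sub>0 real) \<Rightarrow> real" where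
  "tripod_side i x = (if i = 0 then Poly_Mapping.lookup x 1
     else if i = 1 then - Poly_Mapping.lookup x 0
     else Poly_Mapping.lookup x 0 - Poly_Mapping.lookup x 1)"

lemma tripod_in_Rn: "tripod n \<in> Rn 2"
  by (auto simp: tripod_def tripod_ray_def mem_Rn_iff lookup_scaleR lookup_minus lookup_one lookup_single when_def)

lemma linear_tripod_side: "linear (tripod_side i)"
  by (rule linearI) (auto simp: tripod_side_def lookup_add lookup_scaleR algebra_simps)

text \<open>The rays are numbered counterclockwise with angles below 180 degrees between neighbours,
  so the line through one ray separates the other two.\<close>

lemma tripod_side_tripod:
  assumes "i < 3" "n \<ge> 1"
  shows "n mod 3 = i \<Longrightarrow> tripod_side i (tripod n) = 0"
    and "n mod 3 = (i + 1) mod 3 \<Longrightarrow> tripod_side i (tripod n) > 0"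
    and "n mod 3 = (i + 2) mod 3 \<Longrightarrow> tripod_side i (tripod n) < 0"
proof -
  have "i = 0 \<or> i = 1 \<or> i = 2" using assms by auto
  then show "n mod 3 = i \<Longrightarrow> tripod_side i (tripod n) = 0"
    and "n mod 3 = (i + 1) mod 3 \<Longrightarrow> tripod_side i (tripod n) > 0"
    and "n mod 3 = (i + 2) mod 3 \<Longrightarrow> tripod_side i (tripod n) < 0"
    using assms by (auto simp: tripod_side_def tripod_def tripod_ray_def lookup_scaleR lookup_minus lookup_one
        lookup_single when_def)
qed

lemma tripod_eq_imp_eq:
  assumes "tripod n = tripod m" "n mod 3 = m mod 3"
  shows "n = m"
proof -
  have "Poly_Mapping.lookup (tripod_ray i) 0 \<noteq> 0 \<or> Poly_Mapping.lookup (tripod_ray i) 1 \<noteq> 0" for i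
    by (auto simp: tripod_ray_def lookup_minus lookup_one lookup_single when_def)
  then have "tripod_ray (m mod 3) \<noteq> 0" by (metis lookup_zero)
  then show ?thesis using assms by (simp add: tripod_def)
qed

lemma mod3_cases:
  assumes "i < (3::nat)"
  shows "n mod 3 = i \<or> n mod 3 = (i + 1) mod 3 \<or> n mod 3 = (i + 2) mod 3"
proof -
  have "i = 0 \<or> i = 1 \<or> i = 2" "n mod 3 = 0 \<or> n mod 3 = 1 \<or> n mod 3 = 2"
    using assms by auto
  then show ?thesis by auto
qed

lemma card_mod3:
  assumes "i < 3"
  shows "card {n \<in> {1..3 * m}. n mod 3 = i} = m"
proof -
  \<comment> \<open>Residue 0 starts at 3 because the index range starts at 1.\<close>
  let ?g = "\<lambda>q. 3 * q + (if i = 0 then 3 else i)"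
  have "{n \<in> {1..3 * m}. n mod 3 = i} = ?g ` {..<m}"
  proof
    show "?g ` {..<m} \<subseteq> {n \<in> {1..3 * m}. n mod 3 = i}"
      using assms by auto
    show "{n \<in> {1..3 * m}. n mod 3 = i} \<subseteq> ?g ` {..<m}"
    proof
      fix n assume n: "n \<in> {n \<in> {1..3 * m}. n mod 3 = i}"
      have "n = ?g ((n - 1) div 3)" "(n - 1) div 3 < m"
        using n by (auto split: if_splits) presburger+
      then show "n \<in> ?g ` {..<m}" by blast
    qed
  qed
  moreover have "inj_on ?g {..<m}" by (auto simp: inj_on_def)
  ultimately show ?thesis by (simp add: card_image)
qed

lemma tripod_not_partitionable:
  assumes "1 \<le> r"
    and I: "(\<Union>j\<in>{1..r}. I j) = {1..3 * (r - 1)}" "disjoint_family_on I {1..r}"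
    and ne: "\<And>p. p \<in> {1..r} \<Longrightarrow> I p \<noteq> {}"
    and meet: "\<And>p q. \<lbrakk>p \<in> {1..r}; q \<in> {1..r}; p \<noteq> q\<rbrakk> \<Longrightarrow>
      convex hull (tripod ` I p) \<inter> convex hull (tripod ` I q) \<noteq> {}"
  shows False
proof -
  \<comment> \<open>\<open>R i\<close> holds the indices on ray \<open>i\<close>, \<open>M i\<close>
    the parts missing that ray, \<open>D i\<close> the parts with at least two of its
    points.\<close>
  define R where "R i = {n \<in> {1..3 * (r - 1)}. n mod 3 = i}" for i :: nat
  define M where "M i = {j \<in> {1..r}. I j \<inter> R i = {}}" for i
  define D where "D i = {j \<in> {1..r}. 2 \<le> card (I j \<inter> R i)}" for i
  have finR: "finite (R i)" for i by (simp add: R_def)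
  have I_sub: "I j \<subseteq> {1..3 * (r - 1)}" if "j \<in> {1..r}" for j using I(1) that by blast
  have D_M: "card (D i) < card (M i)" if i: "i < 3" for i
  proof -
    have "(\<Sum>j\<in>{1..r}. card (I j \<inter> R i)) = card (\<Union>j\<in>{1..r}. I j \<inter> R i)"
      using I(2) finR by (intro card_UN_disjoint[symmetric]) (auto simp: disjoint_family_on_def)
    also have "(\<Union>j\<in>{1..r}. I j \<inter> R i) = R i" using I(1) by (auto simp: R_def)
    also have "card (R i) = r - 1" using card_mod3[OF i] unfolding R_def .
    finally have sum: "(\<Sum>j\<in>{1..r}. card (I j \<inter> R i)) = r - 1" .
    have MD: "(\<Sum>j\<in>{1..r}. of_bool (j \<in> M i)) = card (M i)" "(\<Sum>j\<in>{1..r}. of_bool (j \<in> D i)) = card (D i)"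
      by (simp_all add: M_def D_def of_bool_def flip: sum.inter_filter)
    \<comment> \<open>Summed over the \<open>r\<close> parts, this gives
      \<open>r + card (D i) \<le> (r - 1) + card (M i)\<close>.\<close>
    have "1 + of_bool (j \<in> D i) \<le> card (I j \<inter> R i) + of_bool (j \<in> M i)" if "j \<in> {1..r}" for j
      using that finR[of i] by (auto simp: D_def M_def Suc_le_eq card_gt_0_iff)
    then have "(\<Sum>j\<in>{1..r}. 1 + of_bool (j \<in> D i)) \<le> (\<Sum>j\<in>{1..r}. card (I j \<inter> R i) + of_bool (j \<in> M i))"
      by (rule sum_mono)
    then have "r + card (D i) \<le> (r - 1) + card (M i)"
      using sum MD by (simp only: sum.distrib) simp
    then show ?thesis using \<open>1 \<le> r\<close> by linarith
  qed
  \<comment> \<open>The line through ray \<open>i\<close> weakly separates the two parts, so a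
    common point of their hulls lies in the hulls of their points on ray \<open>i\<close>.\<close>
  have cross: "I p \<inter> R i \<noteq> {} \<and> (p \<in> D i \<or> q \<in> D i)"
    if i: "i < 3" and p: "p \<in> M ((i + 1) mod 3)" and q: "q \<in> M ((i + 2) mod 3)" and "p \<noteq> q" for i p q
  proof -
    have pr: "p \<in> {1..r}" "q \<in> {1..r}" using p q by (auto simp: M_def)
    have side_p: "n mod 3 = i \<or> tripod_side i (tripod n) < 0" if "n \<in> I p" for n
    proof -
      have "n \<in> {1..3 * (r - 1)}" using that I_sub[OF pr(1)] by blast
      moreover have "n \<notin> R ((i + 1) mod 3)" using p that by (auto simp: M_def)
      ultimately show ?thesis using mod3_cases[OF i, of n] tripod_side_tripod(3)[OF i, of n] by (auto simp: R_def)
    qed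
    have side_q: "n mod 3 = i \<or> tripod_side i (tripod n) > 0" if "n \<in> I q" for n
    proof -
      have "n \<in> {1..3 * (r - 1)}" using that I_sub[OF pr(2)] by blast
      moreover have "n \<notin> R ((i + 2) mod 3)" using q that by (auto simp: M_def)
      ultimately show ?thesis using mod3_cases[OF i, of n] tripod_side_tripod(2)[OF i, of n] by (auto simp: R_def)
    qed
    have zero: "tripod_side i (tripod n) = 0" if "n \<in> I j" "j \<in> {1..r}" "n mod 3 = i" for n j
    proof -
      have "n \<in> {1..3 * (r - 1)}" using that I_sub by blast
      then show ?thesis using that tripod_side_tripod(1)[OF i, of n] by simp
    qed
    obtain x where x: "x \<in> convex hull (tripod ` I p)" "x \<in> convex hull (tripod ` I q)"
      using meet[OF pr \<open>p \<noteq> q\<close>] by blast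
    have le_p: "tripod_side i s \<le> 0" if s: "s \<in> tripod ` I p" for s
    proof -
      obtain n where "n \<in> I p" "s = tripod n" using s by blast
      then show ?thesis using side_p[of n] zero[of n p] pr by auto
    qed
    have ge_q: "- tripod_side i s \<le> 0" if s: "s \<in> tripod ` I q" for s
    proof -
      obtain n where "n \<in> I q" "s = tripod n" using s by blast
      then show ?thesis using side_q[of n] zero[of n q] pr by auto
    qed
    note lin = linear_tripod_side[of i] linear_compose_neg[OF linear_tripod_side[of i]]
    have x0: "tripod_side i x = 0"
      using convex_hull_linear_le[OF lin(1) le_p x(1)] convex_hull_linear_le[OF lin(2) ge_q x(2)]
      by simp
    have "x \<in> convex hull (tripod ` I p \<inter> {s. tripod_side i s = 0})"
      using convex_hull_face[OF lin(1) le_p x(1) x0] by simp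
    moreover have "tripod ` I p \<inter> {s. tripod_side i s = 0} \<subseteq> tripod ` (I p \<inter> R i)"
    proof
      fix s assume "s \<in> tripod ` I p \<inter> {s. tripod_side i s = 0}"
      then obtain n where n: "n \<in> I p" "s = tripod n" "tripod_side i (tripod n) = 0" by auto
      then have "n \<in> R i" using side_p[of n] I_sub[OF pr(1)] by (auto simp: R_def)
      then show "s \<in> tripod ` (I p \<inter> R i)" using n by blast
    qed
    ultimately have xp: "x \<in> convex hull (tripod ` (I p \<inter> R i))" using hull_mono by blast
    have "x \<in> convex hull (tripod ` I q \<inter> {s. - tripod_side i s = 0})"
      using convex_hull_face[OF lin(2) ge_q x(2)] x0 by simp
    moreover have "tripod ` I q \<inter> {s. - tripod_side i s = 0} \<subseteq> tripod ` (I q \<inter> R i)"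
    proof
      fix s assume "s \<in> tripod ` I q \<inter> {s. - tripod_side i s = 0}"
      then obtain n where n: "n \<in> I q" "s = tripod n" "tripod_side i (tripod n) = 0" by auto
      then have "n \<in> R i" using side_q[of n] I_sub[OF pr(2)] by (auto simp: R_def)
      then show "s \<in> tripod ` (I q \<inter> R i)" using n by blast
    qed
    ultimately have xq: "x \<in> convex hull (tripod ` (I q \<inter> R i))" using hull_mono by blast
    have ne_pq: "I p \<inter> R i \<noteq> {}" "I q \<inter> R i \<noteq> {}" using xp xq by auto
    \<comment> \<open>If each part had one point on the ray, the two hulls would be single points,
      distinct because the indices are.\<close>
    moreover have "p \<in> D i \<or> q \<in> D i"
    proof (rule ccontr)
      assume "\<not> (p \<in> D i \<or> q \<in> D i)"
      then have "card (I p \<inter> R i) < 2" "card (I q \<inter> R i) < 2" using pr by (auto simp: D_def)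
      moreover have "card (I p \<inter> R i) > 0" "card (I q \<inter> R i) > 0"
        using ne_pq finR by (auto simp: card_gt_0_iff)
      ultimately have "card (I p \<inter> R i) = 1" "card (I q \<inter> R i) = 1" by linarith+
      then obtain m n where m: "I p \<inter> R i = {m}" and n: "I q \<inter> R i = {n}"
        by (metis card_1_singletonE)
      then have "tripod m = tripod n" using xp xq by simp
      moreover have "m mod 3 = n mod 3" using m n by (auto simp: R_def)
      ultimately have "m = n" by (rule tripod_eq_imp_eq)
      then have "I p \<inter> I q \<noteq> {}" using m n by blast
      then show False using I(2) pr \<open>p \<noteq> q\<close> by (auto simp: disjoint_family_on_def)
    qed
    ultimately show ?thesis by blast
  qed
  \<comment> \<open>Suppose one part \<open>p\<close> misses both other rays, and take
    \<open>s\<close> in the nonempty \<open>M i\<close>. If \<open>s = p\<close>, the part misses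
    all rays and is empty; otherwise \<open>cross\<close> for ray \<open>i + 1\<close> makes
    \<open>p\<close> meet that ray.\<close>
  have M_disj: "p \<noteq> q" if i: "i < 3" and p: "p \<in> M ((i + 1) mod 3)" and q: "q \<in> M ((i + 2) mod 3)" for i p q
  proof
    assume "p = q"
    obtain s where s: "s \<in> M i" using D_M[OF i] by fastforce
    have pr: "p \<in> {1..r}" using p by (auto simp: M_def)
    show False
    proof (cases "s = p")
      case True
      obtain n where n: "n \<in> I p" using ne[OF pr] by blast
      have "n \<in> {1..3 * (r - 1)}" using n I_sub[OF pr] by blast
      then have "n \<in> R i \<or> n \<in> R ((i + 1) mod 3) \<or> n \<in> R ((i + 2) mod 3)"
        using mod3_cases[OF i, of n] by (auto simp: R_def)
      then show False using n p q s \<open>p = q\<close> True unfolding M_def by blast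
    next
      case False
      have "i = 0 \<or> i = 1 \<or> i = 2" using i by auto
      then have shift: "((i + 1) mod 3 + 1) mod 3 = (i + 2) mod 3" "((i + 1) mod 3 + 2) mod 3 = i"
        by (elim disjE; simp)+
      have "(i + 1) mod 3 < 3" by simp
      then have "I p \<inter> R ((i + 1) mod 3) \<noteq> {}"
        using cross[of "(i + 1) mod 3" p s, unfolded shift] q s \<open>p = q\<close> False by metis
      then show False using p by (simp add: M_def)
    qed
  qed
  have fin: "finite (D i)" "finite (M i)" for i by (auto simp: D_def M_def)
  have "card (M ((i + 1) mod 3)) < card (M i) \<or> card (M ((i + 2) mod 3)) < card (M i)" if i: "i < 3" for i
  proof -
    \<comment> \<open>One element of the first set outside \<open>D i\<close> forces the whole
      second set into \<open>D i\<close>.\<close>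
    have "M ((i + 1) mod 3) \<subseteq> D i \<or> M ((i + 2) mod 3) \<subseteq> D i"
      using cross[OF i] M_disj[OF i] by blast
    then show ?thesis using card_mono[OF fin(1)] D_M[OF i] by (meson le_less_trans)
  qed
  \<comment> \<open>An \<open>i\<close> with \<open>card (M i)\<close> minimal gives the
    contradiction.\<close>
  from this[of 0] this[of 1] this[of 2] show False by (auto simp: numeral_2_eq_2)
qed

section \<open>The lower bounds for \<open>T\<close>\<close>

lemma not_forces_partition_plane:
  assumes "2 \<le> k" "k \<le> r"
  shows "\<not> forces_partition 2 r k (3 * (r - 1))"
proof
  assume "forces_partition 2 r k (3 * (r - 1))"
  then obtain I where "relaxed_tverberg_partition (3 * (r - 1)) tripod r k I"
    using tripod_in_Rn unfolding forces_partition_def by blast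
  then have I: "(\<Union>j\<in>{1..r}. I j) = {1..3 * (r - 1)}" "disjoint_family_on I {1..r}"
    and hulls: "\<And>J. J \<subseteq> {1..r} \<Longrightarrow> card J = k \<Longrightarrow> (\<Inter>j\<in>J. convex hull (tripod ` I j)) \<noteq> {}"
    unfolding relaxed_tverberg_partition_def by blast+
  \<comment> \<open>A pair extends to \<open>k\<close> indices. The case \<open>p = q\<close> is
    kept, since it yields that every part is nonempty.\<close>
  have meet: "convex hull (tripod ` I p) \<inter> convex hull (tripod ` I q) \<noteq> {}"
    if pq: "p \<in> {1..r}" "q \<in> {1..r}" for p q
  proof -
    have "card {p, q} \<le> k" using assms card_insert_le_m1[of 2 "{q}" p] by simp
    then obtain J where "{p, q} \<subseteq> J" "J \<subseteq> {1..r}" "card J = k"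
      using exists_subset_between[of "{p, q}" k "{1..r}"] pq assms by auto
    then show ?thesis using hulls[of J] by blast
  qed
  show False
  proof (rule tripod_not_partitionable[OF _ I])
    show "I p \<noteq> {}" if "p \<in> {1..r}" for p
      using meet[OF that that] by auto
  qed (use assms meet in auto)
qed

theorem theorem2p2:
  fixes d r k :: nat
  assumes "2 \<le> d" and "2 \<le> k" and "k \<le> r"
  shows "T (d + 1) r k \<ge> T d r k + (k - 1) \<and>
         T d r k \<ge> 3 * r - 2 + (k - 1) * (d - 2)"
proof
  have k: "1 \<le> k" using assms by simp
  show "T (d + 1) r k \<ge> T d r k + (k - 1)" by (rule T_Suc_ge[OF k assms(3)])
  show "T d r k \<ge> 3 * r - 2 + (k - 1) * (d - 2)"
    using assms(1)
  proof (induction d rule: dec_induct)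
    case base
    \<comment> \<open>Strictness turns \<open>3 * (r - 1)\<close> into the bound
      \<open>3 * r - 2\<close>.\<close>
    have "3 * (r - 1) < T 2 r k"
      using assms by (intro less_T not_forces_partition_plane) auto
    then show ?case by simp
  next
    case (step d)
    have "Suc d - 2 = Suc (d - 2)" using step.hyps by simp
    then show ?case using step.IH T_Suc_ge[OF k assms(3), of d] by simp
  qed
qed

end
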